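(* Let $m\ge 2$, and let $\{f_j\}_{j=1}^n\subset\mathbb R^m$ be unit vectors. Let $d_1=\frac{(m+2)(m-1)}{2}$, $d_2=\frac12(d_1+2)(d_1-1)$ and $a=\frac{d_1+(m-1)^2}{m^2d_1}$. Then there exist unit vectors $\{T^{(2)}_j\}_{j=1}^n\subset\mathbb R^{d_2}$ such that for all $j,l\in\{1,2,\dots,n\}$, $$\left\langle T^{(2)}_j,T^{(2)}_l\right\rangle=\frac{m^2d_1}{(d_1-1)(m-1)^2}\left(\left(|\langle f_j,f_l\rangle|^2-\frac1m\right)^2-\left(a-\frac1{m^2}\right)\right).$$
   Context: All inner products are the standard Euclidean ones. *)

theory Defs
  imports "HOL-Analysis.Analysis"
begin

end

theory Submission
  imports Defs
begin

text \<open>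
  For a unit vector \<open>x\<close> in dimension \<open>m\<close>, the matrices \<open>x x\<^sup>T - I / m\<close> are symmetric and traceless,
  and the inner product of two of them is \<open>(x \<bullet> y)\<^sup>2 - 1 / m\<close>. The space of such matrices has
  dimension \<open>(m + 2) (m - 1) / 2\<close>, so after normalisation one obtains unit vectors in that dimension
  with inner products \<open>m / (m - 1) * ((x \<bullet> y)\<^sup>2 - 1 / m)\<close>. The vectors \<open>T\<^sup>(\<^sup>2\<^sup>)\<close> result from
  applying this construction twice.
\<close>

text \<open>
  Coordinates of \<open>x x\<^sup>T\<close> minus its trace part in an orthonormal basis of the traceless symmetric
  matrices; the diagonal is expanded in the Helmert basis. The entry at \<open>(0, 0)\<close> is a division
  by zero and hence vanishes; it stands for no basis vector.
\<close>

definition traceless_coord :: "(nat \<Rightarrow> real) \<Rightarrow> nat \<times> nat \<Rightarrow> real" where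
  "traceless_coord x = (\<lambda>(i, j).
     if j < i then sqrt 2 * x i * x j
     else ((\<Sum>k<i. (x k)\<^sup>2) - real i * (x i)\<^sup>2) / sqrt (real i * (real i + 1)))"

text \<open>Both sides are the Frobenius inner product of the traceless parts of
  \<open>x x^T\<close> and \<open>y y^T\<close>. In the induction, a new row contributes the cross
  term of the squared inner product off the diagonal, and on it the Helmert term that updates the
  trace correction. The norms stay arbitrary because truncating a unit vector may shorten
  it.\<close>

lemma sum_traceless_coord:
  "(\<Sum>p\<in>(SIGMA i:{..<m}. {..i}). traceless_coord x p * traceless_coord y p) =
     (\<Sum>i<m. x i * y i)\<^sup>2 - (\<Sum>i<m. (x i)\<^sup>2) * (\<Sum>i<m. (y i)\<^sup>2) / real m"
proof -
  have "(\<Sum>i<m. \<Sum>j\<le>i. traceless_coord x (i, j) * traceless_coord y (i, j)) =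
     (\<Sum>i<m. x i * y i)\<^sup>2 - (\<Sum>i<m. (x i)\<^sup>2) * (\<Sum>i<m. (y i)\<^sup>2) / real m"
  proof (induction m)
    case 0
    then show ?case by simp
  next
    case (Suc m)
    define P Q D u v where "P = (\<Sum>i<m. (x i)\<^sup>2)" and "Q = (\<Sum>i<m. (y i)\<^sup>2)"
      and "D = (\<Sum>i<m. x i * y i)" and "u = x m" and "v = y m"
    have off: "(\<Sum>j<m. traceless_coord x (m, j) * traceless_coord y (m, j)) = 2 * u * v * D"
      by (simp add: traceless_coord_def D_def u_def v_def sum_distrib_left mult_ac
            flip: mult.assoc[of "sqrt 2" "sqrt 2"])
    have diag: "traceless_coord x (m, m) * traceless_coord y (m, m) =
        (P - m * u\<^sup>2) * (Q - m * v\<^sup>2) / (real m * (real m + 1))"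
      by (simp add: traceless_coord_def P_def Q_def u_def v_def)
    have "D\<^sup>2 - P * Q / m + (2 * u * v * D + (P - m * u\<^sup>2) * (Q - m * v\<^sup>2) / (real m * (real m + 1))) =
        (D + u * v)\<^sup>2 - (P + u\<^sup>2) * (Q + v\<^sup>2) / (real m + 1)"
    \<comment> \<open>For \<open>m = 0\<close> the divisions by \<open>m\<close> are by zero, but
      \<open>P\<close>, \<open>Q\<close> and \<open>D\<close> are empty sums.\<close>
    proof (cases "m = 0")
      case True
      then show ?thesis by (simp add: P_def Q_def D_def power_mult_distrib)
    next
      case False
      then show ?thesis by (simp add: divide_simps add_nonneg_eq_0_iff) algebra
    qed
    then show ?case
      using Suc.IH
      by (simp add: off diag lessThan_Suc_atMost[symmetric] P_def Q_def D_def u_def v_def add.commute)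
  qed
  then show ?thesis
    by (simp add: sum.Sigma)
qed

lemma traceless_embedding:
  fixes m d :: nat
  assumes "m \<ge> 2" and d: "2 * real d = (real m + 2) * (real m - 1)"
  obtains T :: "(nat \<Rightarrow> real) \<Rightarrow> nat \<Rightarrow> real" where
    "\<And>x y. (\<Sum>i<m. (x i)\<^sup>2) = 1 \<Longrightarrow> (\<Sum>i<m. (y i)\<^sup>2) = 1 \<Longrightarrow>
       (\<Sum>k<d. T x k * T y k) = real m / (real m - 1) * ((\<Sum>i<m. x i * y i)\<^sup>2 - 1 / real m)"
proof -
  \<comment> \<open>The triangle has \<open>m * (m + 1) / 2 = d + 1\<close> positions; dropping the
    spurious \<open>(0, 0)\<close> leaves exactly \<open>d\<close> and changes no sum.\<close>
  define I where "I = (SIGMA i:{..<m}. {..i}) - {(0, 0)}"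
  have "finite I" by (simp add: I_def)
  have "card (SIGMA i:{..<m}. {..i}) = (\<Sum>i<m. Suc i)" by simp
  then have "card I = (\<Sum>i<m. Suc i) - 1"
    using \<open>m \<ge> 2\<close> by (simp add: I_def card_Diff_singleton)
  moreover have "2 * real (\<Sum>i<m. Suc i) = real m * (real m + 1)"
    by (induction m) (auto simp: algebra_simps)
  then have "real (\<Sum>i<m. Suc i) = real (d + 1)"
    using d by (simp add: algebra_simps del: of_nat_sum sum.lessThan_Suc)
  then have "(\<Sum>i<m. Suc i) = d + 1"
    by (simp only: of_nat_eq_iff)
  ultimately have "card I = d" by simp
  then obtain h where h: "bij_betw h {..<d} I"
    using ex_bij_betw_nat_finite[OF \<open>finite I\<close>] by (auto simp: atLeast0LessThan)
  define T where "T x k = sqrt (real m / (real m - 1)) * traceless_coord x (h k)" for x k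
  have "(\<Sum>k<d. T x k * T y k) = real m / (real m - 1) * ((\<Sum>i<m. x i * y i)\<^sup>2 - 1 / real m)"
    if "(\<Sum>i<m. (x i)\<^sup>2) = 1" "(\<Sum>i<m. (y i)\<^sup>2) = 1" for x y
  proof -
    have sq: "real m / (real m - 1) = (sqrt (real m / (real m - 1)))\<^sup>2"
      using \<open>m \<ge> 2\<close> by simp
    have "(\<Sum>k<d. T x k * T y k) =
        real m / (real m - 1) * (\<Sum>k<d. traceless_coord x (h k) * traceless_coord y (h k))"
      unfolding T_def sum_distrib_left by (subst sq) (simp only: power2_eq_square mult_ac)
    also have "(\<Sum>k<d. traceless_coord x (h k) * traceless_coord y (h k)) =
        (\<Sum>p\<in>I. traceless_coord x p * traceless_coord y p)"
      using h by (rule sum.reindex_bij_betw)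
    also have "\<dots> = (\<Sum>p\<in>(SIGMA i:{..<m}. {..i}). traceless_coord x p * traceless_coord y p)"
      unfolding I_def by (intro sum.mono_neutral_left) (auto simp: traceless_coord_def)
    finally show ?thesis
      by (simp add: sum_traceless_coord that)
  qed
  then show thesis by (rule that)
qed

theorem theorem4p10:
  fixes m n d1 d2 :: nat
    and a :: real
    and f :: "nat \<Rightarrow> real ^ 'm"
  assumes m: "m = CARD('m)" and "m \<ge> 2"
    and d1: "real d1 = (real m + 2) * (real m - 1) / 2"
    and d2: "real d2 = 1 / 2 * (real d1 + 2) * (real d1 - 1)"
    and d: "d2 = CARD('d)"
    and a: "a = (real d1 + (real m - 1)\<^sup>2) / ((real m)\<^sup>2 * real d1)"
    and f: "\<And>j. j \<in> {1..n} \<Longrightarrow> norm (f j) = 1"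
  shows "\<exists>T2 :: nat \<Rightarrow> real ^ 'd.
    (\<forall>j\<in>{1..n}. norm (T2 j) = 1) \<and>
    (\<forall>j\<in>{1..n}. \<forall>l\<in>{1..n}.
       T2 j \<bullet> T2 l =
         (real m)\<^sup>2 * real d1 / ((real d1 - 1) * (real m - 1)\<^sup>2) *
         ((\<bar>f j \<bullet> f l\<bar>\<^sup>2 - 1 / real m)\<^sup>2 - (a - 1 / (real m)\<^sup>2)))"
proof -
  \<comment> \<open>This bound makes the embedding applicable a second time, in dimension
    \<open>d1\<close>.\<close>
  have "2 * 1 \<le> (real m + 2) * (real m - 1) / 2"
    using mult_mono[of 4 "real m + 2" 1 "real m - 1"] \<open>m \<ge> 2\<close> by simp
  then have "d1 \<ge> 2" using d1 by linarith
  obtain S where S: "\<And>x y. (\<Sum>i<m. (x i)\<^sup>2) = 1 \<Longrightarrow> (\<Sum>i<m. (y i)\<^sup>2) = 1 \<Longrightarrow>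
      (\<Sum>k<d1. S x k * S y k) = real m / (real m - 1) * ((\<Sum>i<m. x i * y i)\<^sup>2 - 1 / real m)"
    using traceless_embedding[of m d1] \<open>m \<ge> 2\<close> d1 by (auto simp: field_simps)
  obtain T where T: "\<And>x y. (\<Sum>i<d1. (x i)\<^sup>2) = 1 \<Longrightarrow> (\<Sum>i<d1. (y i)\<^sup>2) = 1 \<Longrightarrow>
      (\<Sum>k<d2. T x k * T y k) = real d1 / (real d1 - 1) * ((\<Sum>i<d1. x i * y i)\<^sup>2 - 1 / real d1)"
    using traceless_embedding[of d1 d2] \<open>d1 \<ge> 2\<close> d2 by (auto simp: field_simps)
  obtain b :: "nat \<Rightarrow> 'm" where b: "bij_betw b {..<m} UNIV"
    using ex_bij_betw_nat_finite[of "UNIV :: 'm set"] m by (auto simp: atLeast0LessThan)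
  obtain c :: "'d \<Rightarrow> nat" where c: "bij_betw c UNIV {..<d2}"
    using ex_bij_betw_finite_nat[of "UNIV :: 'd set"] d by (auto simp: atLeast0LessThan)
  \<comment> \<open>The embeddings act on functions on \<open>nat\<close>, so \<open>b\<close> and
    \<open>c\<close> translate from and to the vector types.\<close>
  define g where "g j i = f j $ b i" for j i
  define T2 :: "nat \<Rightarrow> real ^ 'd" where "T2 j = (\<chi> k. T (S (g j)) (c k))" for j
  have g: "(\<Sum>i<m. g j i * g l i) = f j \<bullet> f l" for j l
    unfolding g_def inner_vec_def
    using sum.reindex_bij_betw[OF b, of "\<lambda>i. f j $ i * f l $ i"] by simp
  have g1: "(\<Sum>i<m. (g j i)\<^sup>2) = 1" if "j \<in> {1..n}" for j
    using f[OF that] g[of j j] by (simp add: power2_eq_square norm_eq_1)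
  have unit: "x / (x - 1) * (1 - 1 / x) = 1" if "x \<ge> 2" for x :: real
    using that by (simp add: field_simps)
  have ff: "f j \<bullet> f j = 1" if "j \<in> {1..n}" for j
    using f[OF that] by (simp add: norm_eq_1)
  \<comment> \<open>The second embedding accepts only unit vectors, so the first must produce
    them.\<close>
  have S1: "(\<Sum>k<d1. (S (g j) k)\<^sup>2) = 1" if "j \<in> {1..n}" for j
    using S[OF g1 g1, OF that that] unit[of "real m"] \<open>m \<ge> 2\<close> unfolding g ff[OF that]
    by (simp add: power2_eq_square del: times_divide_eq_left)
  have T2: "T2 j \<bullet> T2 l =
      real d1 / (real d1 - 1) * ((real m / (real m - 1) * ((f j \<bullet> f l)\<^sup>2 - 1 / real m))\<^sup>2 - 1 / real d1)"
    if "j \<in> {1..n}" "l \<in> {1..n}" for j l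
  proof -
    have "T2 j \<bullet> T2 l = (\<Sum>k<d2. T (S (g j)) k * T (S (g l)) k)"
      unfolding T2_def inner_vec_def
      using sum.reindex_bij_betw[OF c, of "\<lambda>k. T (S (g j)) k * T (S (g l)) k"] by simp
    then show ?thesis
      using that by (simp add: T S1 S g1 g)
  qed
  have "norm (T2 j) = 1" if "j \<in> {1..n}" for j
    using T2[OF that that] unit[of "real m"] unit[of "real d1"] \<open>m \<ge> 2\<close> \<open>d1 \<ge> 2\<close>
    by (simp add: norm_eq_1 ff[OF that] del: times_divide_eq_left)
  moreover have "T2 j \<bullet> T2 l =
         (real m)\<^sup>2 * real d1 / ((real d1 - 1) * (real m - 1)\<^sup>2) *
         ((\<bar>f j \<bullet> f l\<bar>\<^sup>2 - 1 / real m)\<^sup>2 - (a - 1 / (real m)\<^sup>2))"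
    if "j \<in> {1..n}" "l \<in> {1..n}" for j l
  proof -
    \<comment> \<open>This is the \<open>1 / d1\<close> of the second embedding, divided by the
      square of the first normalisation factor \<open>m / (m - 1)\<close>; \<open>scale\<close>
      pulls that factor out of the square.\<close>
    have "a - 1 / (real m)\<^sup>2 = (real m - 1)\<^sup>2 / ((real m)\<^sup>2 * real d1)"
      using \<open>m \<ge> 2\<close> \<open>d1 \<ge> 2\<close> by (simp add: a field_simps)
    moreover have scale: "p / e * ((r / q * z)\<^sup>2 - 1 / p) = r\<^sup>2 * p / (e * q\<^sup>2) * (z\<^sup>2 - q\<^sup>2 / (r\<^sup>2 * p))"
      if "p \<noteq> 0" "q \<noteq> 0" "r \<noteq> 0" for p q r e z :: real
      using that by (simp add: power_mult_distrib power_divide right_diff_distrib)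
    ultimately show ?thesis
      using T2[OF that] scale[of "real d1" "real m - 1" "real m" "real d1 - 1" "(f j \<bullet> f l)\<^sup>2 - 1 / real m"]
        \<open>m \<ge> 2\<close> \<open>d1 \<ge> 2\<close> by (simp only: power2_abs)
  qed
  ultimately show ?thesis by blast
qed

end
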